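(* Let $n$ be a positive integer such that $\alpha(n-2)\ge 3$, let $k=n-3$, and let $d=(n-1)(2^{k+1}-2)+k$. Then $\beta(d)>n$.
   Context: For a nonnegative integer $t$, $\alpha(t)$ is the number of $1$'s in the binary expansion of $t$. For a positive integer $d$, $\beta(d)=\min\{s\in\mathbb{N} : d=(2^{i_1}-1)+\cdots+(2^{i_s}-1)\text{ for some } i_1,\dots,i_s\in\mathbb{N}\}$. *)

theory Defs
  imports Main
begin

definition alpha :: "nat \<Rightarrow> nat" where
  "alpha t = card {i. bit t i}"

(* The exponents are arbitrary natural numbers; an exponent 0 contributes a zero
   summand, so whether it is admitted does not affect the minimum. *)
definition beta :: "nat \<Rightarrow> nat" where
  "beta d = (LEAST s. \<exists>i :: nat \<Rightarrow> nat. d = (\<Sum>j<s. (2 ^ i j - 1)))"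

(* The minimum is over a nonempty set, so LEAST is attained. *)
lemma beta_attained: "\<exists>i :: nat \<Rightarrow> nat. d = (\<Sum>j<beta d. (2 ^ i j - 1))"
proof -
  have "d = (\<Sum>j<d. 2 ^ (\<lambda>_. 1 :: nat) j - 1)"
    by simp
  then have "\<exists>s. \<exists>i :: nat \<Rightarrow> nat. d = (\<Sum>j<s. (2 ^ i j - 1))"
    by (intro exI)
  then show ?thesis
    unfolding beta_def by (rule LeastI_ex)
qed

end

(* If beta d <= n, padding with zero summands writes d as a sum of exactly n numbers 2^i - 1, so
   d + n is a sum of n powers of two and alpha (d + n) <= n. But
   d + n = (n - 2) * 2^(n - 2) + (2^(n - 2) - 1), hence
   alpha (d + n) = alpha (n - 2) + (n - 2) >= n + 1. *)
theory Submission imports Defs begin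

text \<open>A set bit at \<open>i\<close> forces \<open>2 ^ i \<le> t\<close>, and
  \<open>i < 2 ^ i\<close>. Finiteness matters since \<open>card\<close> of an infinite set is
  0.\<close>

lemma finite_bits_nat: "finite {i. bit (t :: nat) i}"
proof (rule finite_subset)
  show "{i. bit t i} \<subseteq> {..<t}"
  proof
    fix i assume "i \<in> {i. bit t i}"
    then have "t div 2 ^ i \<noteq> 0"
      by (auto simp: bit_iff_odd intro!: Nat.gr0I)
    then have "2 ^ i \<le> t"
      by (metis div_less not_le)
    with less_exp[of i] show "i \<in> {..<t}"
      unfolding lessThan_iff by (rule less_le_trans)
  qed
qed simp

lemma alpha_0 [simp]: "alpha 0 = 0"
  by (simp add: alpha_def)

lemma alpha_rec: "alpha t = t mod 2 + alpha (t div 2)"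
proof -
  have "{i. bit t i} = (if odd t then {0} else {}) \<union> Suc ` {i. bit (t div 2) i}"
    by (auto simp: bit_Suc bit_0 image_iff elim: not0_implies_Suc split: if_splits)
       (metis bit_0 bit_Suc not0_implies_Suc)+
  moreover have "card (Suc ` {i. bit (t div 2) i}) = alpha (t div 2)"
    by (simp add: alpha_def card_image)
  ultimately show ?thesis
    using finite_bits_nat[of "t div 2"]
    by (simp add: alpha_def card_insert_if odd_iff_mod_2_eq_one)
qed

text \<open>For even \<open>t\<close> only the last bit changes; for odd \<open>t\<close> the last
  bit is cleared and a carry passes to \<open>t div 2\<close>.\<close>

lemma alpha_Suc_le: "alpha (Suc t) \<le> Suc (alpha t)"
proof (induction t rule: less_induct)
  case (less t)
  show ?case
  proof (cases "even t")
    case True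
    then show ?thesis
      using alpha_rec[of t] alpha_rec[of "Suc t"] by (simp add: mod_Suc)
  next
    case False
    then have "t div 2 < t"
      by (cases t) auto
    from less.IH[OF this] show ?thesis
      using False alpha_rec[of t] alpha_rec[of "Suc t"]
      by (simp add: odd_iff_mod_2_eq_one)
  qed
qed

lemma alpha_add_le: "alpha (t + r) \<le> alpha t + r"
proof (induction r)
  case (Suc r)
  then show ?case
    using alpha_Suc_le[of "t + r"] by simp
qed simp

text \<open>For a positive exponent the last bit stays and \<open>t div 2\<close> gains the next
  lower power.\<close>

lemma alpha_add_power2_le: "alpha (t + 2 ^ i) \<le> Suc (alpha t)"
proof (induction i arbitrary: t)
  case 0
  then show ?case
    using alpha_Suc_le by simp
next
  case (Suc i)
  then show ?case
    using Suc[of "t div 2"] alpha_rec[of t] alpha_rec[of "t + 2 ^ Suc i"]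
    by (simp add: add.commute)
qed

lemma alpha_sum_power2_le: "alpha (\<Sum>j<s. 2 ^ i j) \<le> s"
proof (induction s)
  case (Suc s)
  then show ?case
    using alpha_add_power2_le[of "\<Sum>j<s. 2 ^ i j" "i s"] by simp
qed simp

text \<open>The left-hand number is \<open>t\<close> in binary with \<open>a\<close> ones appended;
  each induction step appends one.\<close>

lemma alpha_mult_power2_add_ones: "alpha (t * 2 ^ a + (2 ^ a - 1)) = alpha t + a"
proof (induction a)
  case (Suc a)
  obtain p :: nat where p: "2 ^ a = Suc p"
    by (metis not0_implies_Suc power_not_zero zero_neq_numeral)
  have "t * 2 ^ Suc a + (2 ^ Suc a - 1) = Suc (2 * (t * 2 ^ a + (2 ^ a - 1)))"
    by (simp add: p)
  then show ?case
    using Suc alpha_rec[of "t * 2 ^ Suc a + (2 ^ Suc a - 1)"] by simp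
qed simp

lemma alpha_add_le_if_beta_le:
  assumes "beta d \<le> n"
  shows "alpha (d + n) \<le> n"
proof -
  obtain i :: "nat \<Rightarrow> nat" where i: "d = (\<Sum>j<beta d. (2 ^ i j - 1))"
    using beta_attained by blast
  have "d + beta d = (\<Sum>j<beta d. (2 ^ i j - 1)) + (\<Sum>j<beta d. 1)"
    by (subst (1) i) simp
  also have "\<dots> = (\<Sum>j<beta d. 2 ^ i j)"
    by (simp flip: sum.distrib del: sum_constant)
  finally have "alpha (d + beta d) \<le> beta d"
    using alpha_sum_power2_le by simp
  \<comment> \<open>The remaining \<open>n - beta d\<close> units stand for the zero summands of the
    padding; each raises \<open>alpha\<close> by at most 1.\<close>
  then show ?thesis
    using alpha_add_le[of "d + beta d" "n - beta d"] assms by simp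
qed

theorem proposition1p5:
  fixes n k d :: nat
  assumes "n > 0"
    and "alpha (n - 2) \<ge> 3"
    and "k = n - 3"
    and "d = (n - 1) * (2 ^ (k + 1) - 2) + k"
  shows "beta d > n"
proof (rule ccontr)
  assume "\<not> beta d > n"
  then have le: "alpha (d + n) \<le> n"
    by (simp add: alpha_add_le_if_beta_le)
  have "n \<ge> 4"
  proof (rule ccontr)
    assume "\<not> n \<ge> 4"
    then have "n - 2 \<le> 1"
      by simp
    then show False
      \<comment> \<open>Starting from 0, the bound reads
        \<open>alpha (n - 2) \<le> n - 2\<close>.\<close>
      using alpha_add_le[of 0 "n - 2"] assms(2) by simp
  qed
  then obtain m where n: "n = m + 4"
    using le_Suc_ex[of 4 n] by (auto simp: add.commute)
  \<comment> \<open>Writing \<open>2 ^ m\<close> as a successor makes the truncated subtractions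
    exact, so the identity below is polynomial in \<open>m\<close> and \<open>p\<close>.\<close>
  obtain p :: nat where p: "2 ^ m = Suc p"
    by (metis not0_implies_Suc power_not_zero zero_neq_numeral)
  have "d + n = (n - 2) * 2 ^ (n - 2) + (2 ^ (n - 2) - 1)"
    using p by (simp add: assms(3,4) n power_add algebra_simps)
  then have "alpha (d + n) = alpha (n - 2) + (n - 2)"
    by (simp only: alpha_mult_power2_add_ones)
  with le assms(2) n show False
    by simp
qed

end
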